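(* Let $S$ be a discrete semigroup, let $\mathcal{F}$ be a filter on $S$ such that $\overline{\mathcal{F}}$ is a closed subsemigroup of $\beta S$, and let $x\in\overline{\mathcal{F}}$. Consider the statements: (a) $x\in K(\overline{\mathcal{F}})$; (b) $x$ is $\mathcal{F}$-uniformly recurrent in the dynamical system $(\beta S,\langle\lambda_s\rangle_{s\in S})$; (c) $\overline{\mathcal{F}}x$ is a minimal left ideal of $\overline{\mathcal{F}}$. Statements (a) and (b) are equivalent and imply (c). If $\overline{\mathcal{F}}$ has a left cancelable element, all three are equivalent.
   Context: $\beta S$ is the space of ultrafilters on $S$, with basic sets $\overline{A}=\{p\in\beta S: A\in p\}$. For $x\in S$, $A,G\subseteq S$ put $x^{-1}A=\{y\in S: xy\in A\}$ and $G^{-1}A=\bigcup_{x\in G}x^{-1}A$. The operation on $\beta S$: $A\in p\cdot q$ iff $\{x\in S: x^{-1}A\in q\}\in p$. $\overline{\mathcal{F}}=\{p\in\beta S:\mathcal{F}\subseteq p\}$; $K(\overline{\mathcal{F}})$ is the smallest two-sided ideal of the compact right topological semigroup $\overline{\mathcal{F}}$. For $s\in S$, $\lambda_s:\beta S\to\beta S$ is $\lambda_s(q)=sq$. An element $z\in\overline{\mathcal{F}}$ is left cancelable if $za=zb$ implies $a=b$ for all $a,b\in\overline{\mathcal{F}}$. A dynamical system $(X,\langle T_s\rangle_{s\in S})$ consists of a compact Hausdorff space $X$ and continuous maps $T_s:X\to X$ with $T_s\circ T_t=T_{st}$. A set $A\subseteq S$ is $\mathcal{F}$-syndetic if for every $V\in\mathcal{F}$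 there is a finite $G\subseteq V$ with $G^{-1}A\in\mathcal{F}$. A point $x\in X$ is $\mathcal{F}$-uniformly recurrent if for each neighbourhood $W$ of $x$, $\{s\in S: T_s(x)\in W\}$ is $\mathcal{F}$-syndetic. *)

theory Defs
  imports "HOL-Analysis.Analysis"
begin

text \<open>The discrete semigroup is a type of class \<^class>\<open>semigroup_mult\<close>, and filters on it are the
  library filters, read as families of sets: a set belongs to a filter iff its membership predicate
  holds eventually. The order on library filters is reversed inclusion of these families.\<close>

abbreviation mem_filter :: "'a set \<Rightarrow> 'a filter \<Rightarrow> bool"  (infix "\<in>\<^sub>F" 50)
  where "A \<in>\<^sub>F p \<equiv> eventually (\<lambda>x. x \<in> A) p"

definition betaS :: "'a filter set"
  where "betaS = {p. p \<noteq> bot \<and> (\<forall>A. A \<in>\<^sub>F p \<or> (- A) \<in>\<^sub>F p)}"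

definition basic :: "'a set \<Rightarrow> 'a filter set"
  where "basic A = {p \<in> betaS. A \<in>\<^sub>F p}"

definition beta_topology :: "'a filter topology"
  where "beta_topology = topology_generated_by (range basic)"

definition left_quotient :: "'a::semigroup_mult \<Rightarrow> 'a set \<Rightarrow> 'a set"
  where "left_quotient x A = {y. x * y \<in> A}"

definition set_quotient :: "'a::semigroup_mult set \<Rightarrow> 'a set \<Rightarrow> 'a set"
  where "set_quotient G A = (\<Union>x\<in>G. left_quotient x A)"

definition beta_mult :: "'a::semigroup_mult filter \<Rightarrow> 'a filter \<Rightarrow> 'a filter"  (infixl "\<odot>" 70)
  where "p \<odot> q = Abs_filter (\<lambda>P. {x. left_quotient x (Collect P) \<in>\<^sub>F q} \<in>\<^sub>F p)"

text \<open>The points of the semigroup sit in its compactification as principal ultrafilters.\<close>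

definition lambda_map :: "'a::semigroup_mult \<Rightarrow> 'a filter \<Rightarrow> 'a filter"
  where "lambda_map s q = principal {s} \<odot> q"

definition filter_closure :: "'a filter \<Rightarrow> 'a filter set"
  where "filter_closure F = {p \<in> betaS. \<forall>A. A \<in>\<^sub>F F \<longrightarrow> A \<in>\<^sub>F p}"

definition subsemigroup :: "'a::semigroup_mult filter set \<Rightarrow> bool"
  where "subsemigroup T \<longleftrightarrow> T \<noteq> {} \<and> T \<subseteq> betaS \<and> (\<forall>p\<in>T. \<forall>q\<in>T. p \<odot> q \<in> T)"

definition left_ideal :: "'a::semigroup_mult filter set \<Rightarrow> 'a filter set \<Rightarrow> bool"
  where "left_ideal T L \<longleftrightarrow> L \<noteq> {} \<and> L \<subseteq> T \<and> (\<forall>t\<in>T. \<forall>l\<in>L. t \<odot> l \<in> L)"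

definition right_ideal :: "'a::semigroup_mult filter set \<Rightarrow> 'a filter set \<Rightarrow> bool"
  where "right_ideal T R \<longleftrightarrow> R \<noteq> {} \<and> R \<subseteq> T \<and> (\<forall>t\<in>T. \<forall>r\<in>R. r \<odot> t \<in> R)"

definition two_sided_ideal :: "'a::semigroup_mult filter set \<Rightarrow> 'a filter set \<Rightarrow> bool"
  where "two_sided_ideal T I \<longleftrightarrow> left_ideal T I \<and> right_ideal T I"

definition minimal_left_ideal :: "'a::semigroup_mult filter set \<Rightarrow> 'a filter set \<Rightarrow> bool"
  where "minimal_left_ideal T L \<longleftrightarrow>
    left_ideal T L \<and> (\<forall>M. left_ideal T M \<and> M \<subseteq> L \<longrightarrow> M = L)"

text \<open>The smallest two-sided ideal is obtained as the intersection of all of them; the lemma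
  \<open>smallest_ideal_eqI\<close> below shows that this is the least ideal whenever there is one.\<close>

definition smallest_ideal :: "'a::semigroup_mult filter set \<Rightarrow> 'a filter set"
  where "smallest_ideal T = \<Inter>{I. two_sided_ideal T I}"

definition left_cancelable :: "'a::semigroup_mult filter set \<Rightarrow> 'a filter \<Rightarrow> bool"
  where "left_cancelable T z \<longleftrightarrow> z \<in> T \<and> (\<forall>a\<in>T. \<forall>b\<in>T. z \<odot> a = z \<odot> b \<longrightarrow> a = b)"

definition dynamical_system :: "'x topology \<Rightarrow> ('a::semigroup_mult \<Rightarrow> 'x \<Rightarrow> 'x) \<Rightarrow> bool"
  where "dynamical_system X T \<longleftrightarrow> compact_space X \<and> Hausdorff_space X \<and>
    (\<forall>s. continuous_map X X (T s)) \<and> (\<forall>s t. \<forall>x\<in>topspace X. T s (T t x) = T (s * t) x)"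

definition syndetic :: "'a::semigroup_mult filter \<Rightarrow> 'a set \<Rightarrow> bool"
  where "syndetic F A \<longleftrightarrow> (\<forall>V. V \<in>\<^sub>F F \<longrightarrow> (\<exists>G. finite G \<and> G \<subseteq> V \<and> set_quotient G A \<in>\<^sub>F F))"

definition uniformly_recurrent ::
    "'a::semigroup_mult filter \<Rightarrow> 'x topology \<Rightarrow> ('a \<Rightarrow> 'x \<Rightarrow> 'x) \<Rightarrow> 'x \<Rightarrow> bool"
  where "uniformly_recurrent F X T x \<longleftrightarrow> x \<in> topspace X \<and>
    (\<forall>W. W \<subseteq> topspace X \<and> (\<exists>U. openin X U \<and> x \<in> U \<and> U \<subseteq> W) \<longrightarrow> syndetic F {s. T s x \<in> W})"


lemma smallest_ideal_eqI:
  assumes "two_sided_ideal T I" "\<And>J. two_sided_ideal T J \<Longrightarrow> I \<subseteq> J"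
  shows "smallest_ideal T = I"
  using assms unfolding smallest_ideal_def by blast

lemma eventually_beta_mult:
  "eventually P (p \<odot> q) \<longleftrightarrow> eventually (\<lambda>x. eventually (\<lambda>y. P (x * y)) q) p"
proof -
  have "is_filter (\<lambda>P. {x. left_quotient x (Collect P) \<in>\<^sub>F q} \<in>\<^sub>F p)"
    unfolding left_quotient_def
    by unfold_locales (auto elim!: eventually_mono eventually_elim2 simp: eventually_conj_iff)
  then show ?thesis
    by (simp add: beta_mult_def eventually_Abs_filter left_quotient_def)
qed

lemma mem_beta_mult: "A \<in>\<^sub>F p \<odot> q \<longleftrightarrow> {x. left_quotient x A \<in>\<^sub>F q} \<in>\<^sub>F p"
  by (simp add: eventually_beta_mult left_quotient_def)

lemma beta_mult_assoc: "(p \<odot> q) \<odot> r = p \<odot> (q \<odot> r)"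
  by (simp add: filter_eq_iff eventually_beta_mult mult.assoc)

lemma mem_lambda_map: "A \<in>\<^sub>F lambda_map s q \<longleftrightarrow> left_quotient s A \<in>\<^sub>F q"
  by (simp add: lambda_map_def mem_beta_mult eventually_principal)

lemma ultra_not: "p \<in> betaS \<Longrightarrow> (- A) \<in>\<^sub>F p \<longleftrightarrow> \<not> A \<in>\<^sub>F p"
proof -
  assume p: "p \<in> betaS"
  have "\<not> (A \<in>\<^sub>F p \<and> (- A) \<in>\<^sub>F p)"
  proof
    assume "A \<in>\<^sub>F p \<and> (- A) \<in>\<^sub>F p"
    then have "eventually (\<lambda>x. x \<in> A \<and> x \<in> - A) p" by (simp only: eventually_conj_iff)
    then show False using p by (simp add: betaS_def trivial_limit_def)
  qed
  then show ?thesis using p unfolding betaS_def by blast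
qed

lemma principal_in_betaS: "principal {s} \<in> betaS"
  by (auto simp: betaS_def eventually_principal principal_eq_bot_iff)

lemma beta_mult_in_betaS:
  assumes "p \<in> betaS" "q \<in> betaS" shows "p \<odot> q \<in> betaS"
proof -
  have "p \<odot> q \<noteq> bot"
    using assms by (simp add: betaS_def trivial_limit_def eventually_beta_mult)
  moreover have "A \<in>\<^sub>F p \<odot> q \<or> (- A) \<in>\<^sub>F p \<odot> q" for A
  proof -
    have "left_quotient x (- A) = - left_quotient x A" for x
      by (auto simp: left_quotient_def)
    then have eq: "{x. left_quotient x (- A) \<in>\<^sub>F q} = - {x. left_quotient x A \<in>\<^sub>F q}"
      by (auto simp: ultra_not[OF assms(2)] simp del: Compl_iff)
    show ?thesis
      unfolding mem_beta_mult eq ultra_not[OF assms(1)] by (rule disj_commute[THEN iffD1, OF excluded_middle])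
  qed
  ultimately show ?thesis by (simp add: betaS_def)
qed

lemma basic_subset: "basic A \<subseteq> betaS"
  by (auto simp: basic_def)

lemma topspace_beta [simp]: "topspace beta_topology = betaS"
proof -
  have "betaS = basic UNIV" by (simp add: basic_def)
  then show ?thesis
    unfolding beta_topology_def topology_generated_by_topspace by (blast intro: subset_antisym dest: basic_subset[THEN subsetD])
qed

lemma openin_basic: "openin beta_topology (basic A)"
  unfolding beta_topology_def by (rule topology_generated_by_Basis) simp

lemma exists_ultrafilter_le:
  assumes "F \<noteq> bot" shows "\<exists>p\<in>betaS. p \<le> F"
proof -
  let ?r = "\<lambda>p q :: 'a filter. q \<le> p"
  have po: "partial_order_on {p. p \<noteq> bot \<and> p \<le> F} (relation_of ?r {p. p \<noteq> bot \<and> p \<le> F})"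
    by (rule partial_order_on_relation_ofI) auto
  have "\<exists>m\<in>{p. p \<noteq> bot \<and> p \<le> F}. \<forall>a\<in>{p. p \<noteq> bot \<and> p \<le> F}. a \<le> m \<longrightarrow> a = m"
  proof (rule predicate_Zorn[OF po])
    fix C assume C: "C \<in> Chains (relation_of ?r {p. p \<noteq> bot \<and> p \<le> F})"
    have sub: "C \<subseteq> {p. p \<noteq> bot \<and> p \<le> F}"
      using C unfolding Chains_def relation_of_def by blast
    have ch: "a \<le> b \<or> b \<le> a" if "a \<in> C" "b \<in> C" for a b
      using C that unfolding Chains_def relation_of_def by blast
    show "\<exists>u\<in>{p. p \<noteq> bot \<and> p \<le> F}. \<forall>a\<in>C. u \<le> a"
    proof (cases "C = {}")
      case True then show ?thesis using assms by auto
    next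
      case False
      have "eventually P (Inf C) \<longleftrightarrow> (\<exists>b\<in>C. eventually P b)" for P
        by (rule eventually_Inf_base[OF False]) (metis ch inf.absorb1 inf.absorb2 order_refl)
      then have "Inf C \<noteq> bot" using sub by (auto simp: trivial_limit_def)
      moreover have "Inf C \<le> F" using False sub
        by (metis (no_types, lifting) Inf_lower2 ex_in_conv mem_Collect_eq subset_iff)
      ultimately show ?thesis by (intro bexI[of _ "Inf C"]) (auto intro: Inf_lower)
    qed
  qed
  then obtain m where m: "m \<noteq> bot" "m \<le> F"
    and max: "\<And>a. a \<noteq> bot \<Longrightarrow> a \<le> F \<Longrightarrow> a \<le> m \<Longrightarrow> a = m" by blast
  have "A \<in>\<^sub>F m \<or> (- A) \<in>\<^sub>F m" for A
  proof (cases "inf m (principal A) = bot")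
    case True
    then have "(- A) \<in>\<^sub>F m"
      by (simp add: trivial_limit_def eventually_inf_principal)
    then show ?thesis ..
  next
    case False
    then have "inf m (principal A) = m"
      using max m(2) by (meson inf.cobounded1 order_trans)
    then have "m \<le> principal A" by (metis inf.cobounded2)
    then show ?thesis by (simp add: le_principal)
  qed
  with m show ?thesis by (auto simp: betaS_def)
qed

lemma basic_base:
  assumes "openin beta_topology U" "p \<in> U"
  shows "\<exists>A. p \<in> basic A \<and> basic A \<subseteq> U"
proof -
  have "generate_topology_on (range basic) U"
    using assms(1) by (simp add: beta_topology_def openin_topology_generated_by_iff)
  then show ?thesis using assms(2)
  proof (induction arbitrary: p)
    case Empty then show ?case by simp
  next
    case (Int U V)
    then obtain A B where "p \<in> basic A" "basic A \<subseteq> U" "p \<in> basic B" "basic B \<subseteq> V" by blast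
    moreover have "basic (A \<inter> B) = basic A \<inter> basic B"
      by (auto simp: basic_def eventually_conj_iff)
    ultimately show ?case by blast
  next
    case (UN K) then show ?case by (meson Union_iff Union_upper order_trans)
  next
    case (Basis s) then show ?case by blast
  qed
qed

lemma compact_beta: "compact_space (beta_topology :: 'a filter topology)"
  unfolding compact_space_alt topspace_beta
proof (intro allI impI, elim conjE)
  fix \<U> :: "'a filter set set"
  assume "\<forall>U\<in>\<U>. openin beta_topology U" and cover: "betaS \<subseteq> \<Union>\<U>"
  then have op: "\<And>U. U \<in> \<U> \<Longrightarrow> openin beta_topology U" by blast
  define \<A> where "\<A> = {A. \<exists>U\<in>\<U>. basic A \<subseteq> U}"
  show "\<exists>\<F>. finite \<F> \<and> \<F> \<subseteq> \<U> \<and> betaS \<subseteq> \<Union>\<F>"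
  proof (rule ccontr)
    assume none: "\<not> ?thesis"
    have "(INF A\<in>\<A>. principal (- A)) \<noteq> bot"
    proof (rule INF_filter_not_bot)
      fix X assume X: "X \<subseteq> \<A>" "finite X"
      then have "\<forall>A\<in>X. \<exists>U. U \<in> \<U> \<and> basic A \<subseteq> U"
        unfolding \<A>_def by blast
      then obtain u where u: "\<forall>A\<in>X. u A \<in> \<U> \<and> basic A \<subseteq> u A"
        by (rule bchoice[THEN exE])
      have "\<not> betaS \<subseteq> \<Union>(u ` X)"
      proof
        assume "betaS \<subseteq> \<Union>(u ` X)"
        moreover have "finite (u ` X)" "u ` X \<subseteq> \<U>" using u X(2) by auto
        ultimately show False using none by blast
      qed
      then obtain p where p: "p \<in> betaS" "\<And>A. A \<in> X \<Longrightarrow> p \<notin> basic A" using u by blast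
      have "\<forall>A\<in>X. (- A) \<in>\<^sub>F p" using p ultra_not[OF p(1)] by (simp add: basic_def)
      then have "(\<Inter>A\<in>X. - A) \<in>\<^sub>F p"
        using eventually_ball_finite[OF X(2), of "\<lambda>x A. x \<in> - A" p] by simp
      moreover have "\<not> {} \<in>\<^sub>F p" using p(1) by (simp add: betaS_def trivial_limit_def)
      ultimately have "(\<Inter>A\<in>X. - A) \<noteq> {}" by fastforce
      then show "(INF A\<in>X. principal (- A)) \<noteq> bot"
        by (simp only: INF_principal_finite[OF X(2)] principal_eq_bot_iff not_False_eq_True)
    qed
    then obtain p where p: "p \<in> betaS" "p \<le> (INF A\<in>\<A>. principal (- A))"
      using exists_ultrafilter_le by blast
    then obtain U where U: "U \<in> \<U>" "p \<in> U" using cover by blast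
    then obtain A where A: "p \<in> basic A" "basic A \<subseteq> U" using basic_base op by blast
    then have "A \<in> \<A>" using U by (auto simp: \<A>_def)
    then have "p \<le> principal (- A)" using p(2) by (meson INF_lower order_trans)
    then have "(- A) \<in>\<^sub>F p" by (simp only: le_principal)
    then show False using A(1) ultra_not[OF p(1)] by (simp add: basic_def)
  qed
qed

lemma Hausdorff_beta: "Hausdorff_space beta_topology"
  unfolding Hausdorff_space_def topspace_beta
proof (intro allI impI, elim conjE)
  fix p q :: "'a filter" assume p: "p \<in> betaS" and q: "q \<in> betaS" and "p \<noteq> q"
  then obtain P where "eventually P p \<noteq> eventually P q"
    unfolding filter_eq_iff by blast
  then have "(Collect P \<in>\<^sub>F p) \<noteq> (Collect P \<in>\<^sub>F q)" by simp
  then have "Collect P \<in>\<^sub>F p \<and> (- Collect P) \<in>\<^sub>F q \<or>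
      (- Collect P) \<in>\<^sub>F p \<and> (- (- Collect P)) \<in>\<^sub>F q"
    unfolding ultra_not[OF p] ultra_not[OF q] by blast
  then have "\<exists>A. A \<in>\<^sub>F p \<and> (- A) \<in>\<^sub>F q" by blast
  then obtain A where A: "A \<in>\<^sub>F p" "(- A) \<in>\<^sub>F q" by blast
  have "disjnt (basic A) (basic (- A))"
    unfolding disjnt_def basic_def using ultra_not by blast
  then show "\<exists>U V. openin beta_topology U \<and> openin beta_topology V \<and> p \<in> U \<and> q \<in> V \<and> disjnt U V"
    using A p q openin_basic unfolding basic_def by blast
qed

lemma dynamical_system_beta: "dynamical_system beta_topology lambda_map"
proof -
  have closed: "lambda_map s q \<in> betaS" if "q \<in> betaS" for s and q :: "'a filter"
    unfolding lambda_map_def by (intro beta_mult_in_betaS principal_in_betaS that)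
  have "continuous_map beta_topology beta_topology (lambda_map s)" for s :: 'a
    unfolding beta_topology_def
  proof (rule continuous_on_generated_topo)
    fix U :: "'a filter set" assume "U \<in> range basic"
    then obtain A where "U = basic A" by blast
    then have "lambda_map s -` U \<inter> betaS = basic (left_quotient s A)"
      using closed by (auto simp: basic_def mem_lambda_map simp del: Compl_iff)
    then show "openin (topology_generated_by (range basic))
        (lambda_map s -` U \<inter> topspace (topology_generated_by (range basic)))"
      using openin_basic topspace_beta unfolding beta_topology_def by metis
  next
    have "\<Union> (range basic) = (betaS :: 'a filter set)"
      using topspace_beta unfolding beta_topology_def topology_generated_by_topspace .
    then show "lambda_map s ` topspace (topology_generated_by (range basic)) \<subseteq> \<Union> (range basic)"
      using closed by auto
  qed
  moreover have "lambda_map s (lambda_map t q) = lambda_map (s * t) q" for s t and q :: "'a filter"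
    by (simp add: filter_eq_iff lambda_map_def eventually_beta_mult eventually_principal mult.assoc)
  ultimately show ?thesis
    by (simp add: dynamical_system_def compact_beta Hausdorff_beta)
qed

end

theory Submission
  imports Defs
begin

text \<open>Write \<open>T\<close> for the closure of \<open>F\<close>. The argument rests on the condition
  (r): \<open>x \<in> T p x\<close> for every \<open>p \<in> T\<close>. It is uniform recurrence read through compactness: a cover of
  \<open>T\<close> by the sets \<open>basic (s\<inverse>B)\<close> with \<open>s \<in> V\<close> has a finite subcover, which is the finite set in the
  definition of syndeticity; conversely \<open>T p x\<close> is closed, so it contains \<open>x\<close> as soon as it meets
  every basic neighbourhood of \<open>x\<close>. On the algebraic side, (r) puts \<open>x\<close> into every two-sided ideal,
  and it holds for every element of a minimal left ideal; minimal left ideals exist by compactness.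
  Finally, if \<open>T x\<close> is a minimal left ideal and \<open>z\<close> is left cancelable, then an idempotent \<open>e\<close> of
  \<open>T x\<close> is a right identity on \<open>T x\<close>, so \<open>z x = z x e\<close>, hence \<open>x = x e\<close> lies in \<open>T x\<close> itself.\<close>

section \<open>Closures of filters and right translations\<close>

text \<open>If \<open>A\<close> were missing from \<open>F\<close>, then \<open>F\<close> together
  with \<open>- A\<close> would generate a proper filter, and an ultrafilter containing that filter
  would be a point of the closure that misses \<open>A\<close>. This is the way back from statements
  about all points of the closure to the filter itself.\<close>

lemma eventually_if_closure:
  assumes "\<And>p. p \<in> filter_closure F \<Longrightarrow> A \<in>\<^sub>F p"
  shows "A \<in>\<^sub>F F"
proof (rule ccontr)
  assume "\<not> A \<in>\<^sub>F F"
  then have "inf F (principal (- A)) \<noteq> bot"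
    by (simp add: trivial_limit_def eventually_inf_principal)
  then obtain p where p: "p \<in> betaS" "p \<le> inf F (principal (- A))"
    using exists_ultrafilter_le by blast
  then have "p \<in> filter_closure F"
    unfolding filter_closure_def by (auto intro: filter_leD)
  moreover have "(- A) \<in>\<^sub>F p"
    using p(2) by (simp only: le_inf_iff le_principal)
  ultimately show False
    using assms ultra_not[OF p(1)] by blast
qed

text \<open>By the definition of the product, the preimage of a basic set is again a basic set. Only
  the left factor varies here; this one-sided continuity makes the translates of a closed set by a
  factor on the right closed.\<close>

lemma continuous_map_beta_mult_right:
  assumes "q \<in> betaS"
  shows "continuous_map beta_topology beta_topology (\<lambda>p. p \<odot> q)"
  unfolding beta_topology_def
proof (rule continuous_on_generated_topo)
  fix U :: "'a filter set" assume "U \<in> range basic"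
  then obtain A where "U = basic A" by blast
  then have "(\<lambda>p. p \<odot> q) -` U \<inter> betaS = basic {x. left_quotient x A \<in>\<^sub>F q}"
    using assms beta_mult_in_betaS by (auto simp: basic_def mem_beta_mult simp del: Collect_mem_eq)
  then show "openin (topology_generated_by (range basic))
      ((\<lambda>p. p \<odot> q) -` U \<inter> topspace (topology_generated_by (range basic)))"
    using openin_basic topspace_beta unfolding beta_topology_def by metis
next
  have "\<Union> (range basic) = (betaS :: 'a filter set)"
    using topspace_beta unfolding beta_topology_def topology_generated_by_topspace .
  then show "(\<lambda>p. p \<odot> q) ` topspace (topology_generated_by (range basic)) \<subseteq> \<Union> (range basic)"
    using assms beta_mult_in_betaS by auto
qed

lemma closedin_translate:
  assumes "closedin beta_topology T" "q \<in> betaS"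
  shows "closedin beta_topology {p \<odot> q | p. p \<in> T}"
proof -
  have "compactin beta_topology ((\<lambda>p. p \<odot> q) ` T)"
    using assms closedin_compact_space compact_beta continuous_map_beta_mult_right
      image_compactin by blast
  moreover have "(\<lambda>p. p \<odot> q) ` T = {p \<odot> q | p. p \<in> T}" by blast
  ultimately show ?thesis
    using compactin_imp_closedin Hausdorff_beta by metis
qed

section \<open>Minimal left ideals and idempotents from compactness\<close>

text \<open>Zorn's lemma for reversed inclusion, with compactness providing lower bounds of chains.
  The family is kept abstract because it is instantiated twice: with closed left ideals and with
  closed subsemigroups.\<close>

lemma ex_minimal_closed:
  assumes ne: "C \<in> \<C>"
    and closed: "\<And>D. D \<in> \<C> \<Longrightarrow> closedin beta_topology D \<and> D \<noteq> {}"
    and inter: "\<And>\<D>. \<D> \<subseteq> \<C> \<Longrightarrow> \<D> \<noteq> {} \<Longrightarrow> \<Inter>\<D> \<noteq> {} \<Longrightarrow> \<Inter>\<D> \<in> \<C>"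
  shows "\<exists>M\<in>\<C>. \<forall>D\<in>\<C>. D \<subseteq> M \<longrightarrow> D = M"
proof -
  have po: "partial_order_on \<C> (relation_of (\<lambda>D E. E \<subseteq> D) \<C>)"
    by (rule partial_order_on_relation_ofI) auto
  show ?thesis
  proof (rule predicate_Zorn[OF po])
    fix \<D> assume "\<D> \<in> Chains (relation_of (\<lambda>D E. E \<subseteq> D) \<C>)"
    then have sub: "\<D> \<subseteq> \<C>" and chain: "\<And>D E. D \<in> \<D> \<Longrightarrow> E \<in> \<D> \<Longrightarrow> D \<subseteq> E \<or> E \<subseteq> D"
      unfolding Chains_def relation_of_def by blast+
    show "\<exists>M\<in>\<C>. \<forall>D\<in>\<D>. M \<subseteq> D"
    proof (cases "\<D> = {}")
      case True
      then show ?thesis using ne by auto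
    next
      case False
      \<comment> \<open>A finite nonempty subfamily of a chain contains its own intersection, so the
        finite intersection property reduces to the members being nonempty.\<close>
      have fip: "\<Inter>\<E> \<noteq> {}" if "finite \<E>" "\<E> \<subseteq> \<D>" for \<E>
      proof (cases "\<E> = {}")
        case False
        have "\<Inter>\<E> \<in> \<E>"
          using that(1) False
        proof (rule finite_Inf_in)
          show "inf D E \<in> \<E>" if "D \<in> \<E>" "E \<in> \<E>" for D E
            using chain that \<open>\<E> \<subseteq> \<D>\<close> by (metis inf.absorb1 inf.absorb2 subsetD)
        qed
        then show ?thesis using that(2) sub closed by blast
      qed simp
      have "\<forall>D\<in>\<D>. closedin beta_topology D" using sub closed by blast
      then have "\<Inter>\<D> \<noteq> {}"
        using compact_beta[unfolded compact_space_fip, rule_format, of \<D>] fip by simp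
      then have "\<Inter>\<D> \<in> \<C>" using inter sub False by blast
      then show ?thesis by blast
    qed
  qed
qed

lemma left_ideal_translate:
  assumes "subsemigroup T" "left_ideal T L" "q \<in> T"
  shows "left_ideal T {l \<odot> q | l. l \<in> L}"
  unfolding left_ideal_def
proof (intro conjI ballI)
  show "{l \<odot> q | l. l \<in> L} \<noteq> {}"
    using assms(2) by (auto simp: left_ideal_def)
  show "{l \<odot> q | l. l \<in> L} \<subseteq> T"
    using assms unfolding subsemigroup_def left_ideal_def by blast
  show "t \<odot> r \<in> {l \<odot> q | l. l \<in> L}" if "t \<in> T" "r \<in> {l \<odot> q | l. l \<in> L}" for t r
  proof -
    from that obtain l where "l \<in> L" "r = l \<odot> q" by blast
    moreover have "t \<odot> l \<in> L"
      using assms(2) \<open>t \<in> T\<close> \<open>l \<in> L\<close> unfolding left_ideal_def by blast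
    ultimately show ?thesis using beta_mult_assoc[of t l q, symmetric] by blast
  qed
qed

lemma left_ideal_self: "subsemigroup T \<Longrightarrow> left_ideal T T"
  by (simp add: left_ideal_def subsemigroup_def)

text \<open>A left ideal \<open>M\<close> inside the translate pulls back to the set of those
  \<open>l\<close> in \<open>L\<close> with \<open>l \<odot> q\<close> in \<open>M\<close>. This is
  a left ideal inside \<open>L\<close>, hence all of \<open>L\<close>, and so \<open>M\<close> is
  the whole translate.\<close>

lemma minimal_left_ideal_translate:
  assumes T: "subsemigroup T" and L: "minimal_left_ideal T L" and q: "q \<in> T"
  shows "minimal_left_ideal T {l \<odot> q | l. l \<in> L}"
  unfolding minimal_left_ideal_def
proof (intro conjI allI impI)
  have LT: "left_ideal T L" using L by (simp add: minimal_left_ideal_def)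
  then show "left_ideal T {l \<odot> q | l. l \<in> L}" using left_ideal_translate T q by blast
  fix M assume "left_ideal T M \<and> M \<subseteq> {l \<odot> q | l. l \<in> L}"
  then have M: "left_ideal T M" and sub: "M \<subseteq> {l \<odot> q | l. l \<in> L}" by auto
  have "left_ideal T {l \<in> L. l \<odot> q \<in> M}"
    unfolding left_ideal_def
  proof (intro conjI ballI)
    obtain m where "m \<in> M" using M unfolding left_ideal_def by auto
    then show "{l \<in> L. l \<odot> q \<in> M} \<noteq> {}" using sub by auto
    show "{l \<in> L. l \<odot> q \<in> M} \<subseteq> T" using LT unfolding left_ideal_def by blast
    show "t \<odot> l \<in> {l \<in> L. l \<odot> q \<in> M}" if "t \<in> T" "l \<in> {l \<in> L. l \<odot> q \<in> M}" for t l
      using that LT M by (simp add: left_ideal_def beta_mult_assoc)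
  qed
  then have "{l \<in> L. l \<odot> q \<in> M} = L"
    using L unfolding minimal_left_ideal_def by blast
  then show "M = {l \<odot> q | l. l \<in> L}" using sub by blast
qed

lemma translate_eq_minimal_left_ideal:
  assumes T: "subsemigroup T" and L: "minimal_left_ideal T L" and y: "y \<in> L"
  shows "{p \<odot> y | p. p \<in> T} = L"
proof -
  have LT: "left_ideal T L" using L by (simp add: minimal_left_ideal_def)
  then have "left_ideal T {p \<odot> y | p. p \<in> T}"
    using left_ideal_translate[OF T left_ideal_self[OF T]] y unfolding left_ideal_def by blast
  moreover have "{p \<odot> y | p. p \<in> T} \<subseteq> L" using LT y unfolding left_ideal_def by blast
  ultimately show ?thesis using L unfolding minimal_left_ideal_def by blast
qed

text \<open>Zorn's lemma only gives an \<open>L\<close> that is minimal among the closed left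
  ideals. Closedness costs nothing: any left ideal inside \<open>L\<close> contains the translate of
  \<open>T\<close> by one of its elements \<open>m\<close>, which is a closed left ideal and
  therefore equals \<open>L\<close>.\<close>

lemma ex_minimal_left_ideal:
  assumes T: "subsemigroup T" and closed: "closedin beta_topology T"
  obtains L where "minimal_left_ideal T L"
proof -
  define \<C> where "\<C> = {L. closedin beta_topology L \<and> left_ideal T L}"
  have "T \<in> \<C>" using assms left_ideal_self by (simp add: \<C>_def)
  moreover have "closedin beta_topology D \<and> D \<noteq> {}" if "D \<in> \<C>" for D
    using that by (auto simp: \<C>_def left_ideal_def)
  moreover have "\<Inter>\<D> \<in> \<C>" if "\<D> \<subseteq> \<C>" "\<D> \<noteq> {}" "\<Inter>\<D> \<noteq> {}" for \<D>
  proof -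
    have "closedin beta_topology (\<Inter>\<D>)" using that unfolding \<C>_def by blast
    moreover have "left_ideal T (\<Inter>\<D>)"
      using that unfolding \<C>_def left_ideal_def by fast
    ultimately show ?thesis by (simp add: \<C>_def)
  qed
  ultimately have "\<exists>L\<in>\<C>. \<forall>D\<in>\<C>. D \<subseteq> L \<longrightarrow> D = L"
    by (rule ex_minimal_closed)
  then obtain L where L: "L \<in> \<C>" and min: "\<And>D. D \<in> \<C> \<Longrightarrow> D \<subseteq> L \<Longrightarrow> D = L"
    by blast
  have "M = L" if M: "left_ideal T M" "M \<subseteq> L" for M
  proof -
    obtain m where m: "m \<in> M" "m \<in> T" using M(1) unfolding left_ideal_def by blast
    then have sub: "{p \<odot> m | p. p \<in> T} \<subseteq> M" using M(1) unfolding left_ideal_def by blast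
    have "m \<in> betaS" using m T unfolding subsemigroup_def by blast
    then have "{p \<odot> m | p. p \<in> T} \<in> \<C>"
      using closedin_translate[OF closed] left_ideal_translate[OF T left_ideal_self[OF T] m(2)]
      by (simp add: \<C>_def)
    then have "{p \<odot> m | p. p \<in> T} = L" using min sub M(2) by blast
    then show ?thesis using sub M(2) by blast
  qed
  then show ?thesis using that[of L] L by (auto simp: \<C>_def minimal_left_ideal_def)
qed

text \<open>The Ellis-Numakura argument: in a minimal closed subsemigroup \<open>M\<close>, every
  element \<open>a\<close> turns out to be idempotent, because first the translate of
  \<open>M\<close> by \<open>a\<close> and then the stabilizer of \<open>a\<close> in
  \<open>M\<close> must be all of \<open>M\<close>.\<close>

lemma ex_idempotent:
  assumes E: "subsemigroup E" and closed: "closedin beta_topology E"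
  obtains e where "e \<in> E" "e \<odot> e = e"
proof -
  define \<C> where "\<C> = {D. closedin beta_topology D \<and> subsemigroup D \<and> D \<subseteq> E}"
  have "E \<in> \<C>" using assms by (simp add: \<C>_def)
  moreover have "closedin beta_topology D \<and> D \<noteq> {}" if "D \<in> \<C>" for D
    using that by (auto simp: \<C>_def subsemigroup_def)
  moreover have "\<Inter>\<D> \<in> \<C>" if "\<D> \<subseteq> \<C>" "\<D> \<noteq> {}" "\<Inter>\<D> \<noteq> {}" for \<D>
  proof -
    have "closedin beta_topology (\<Inter>\<D>)" using that unfolding \<C>_def by blast
    moreover have "subsemigroup (\<Inter>\<D>)"
    proof -
      have "subsemigroup D" if "D \<in> \<D>" for D
        using that \<open>\<D> \<subseteq> \<C>\<close> by (auto simp: \<C>_def)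
      then show ?thesis using that(2,3) by (simp add: subsemigroup_def Inf_less_eq)
    qed
    moreover have "\<Inter>\<D> \<subseteq> E" using that unfolding \<C>_def by blast
    ultimately show ?thesis by (simp add: \<C>_def)
  qed
  ultimately have "\<exists>M\<in>\<C>. \<forall>D\<in>\<C>. D \<subseteq> M \<longrightarrow> D = M"
    by (rule ex_minimal_closed)
  then obtain M where M: "M \<in> \<C>" and min: "\<And>D. D \<in> \<C> \<Longrightarrow> D \<subseteq> M \<Longrightarrow> D = M"
    by blast
  have Mc: "closedin beta_topology M" and Ms: "subsemigroup M" and ME: "M \<subseteq> E"
    using M by (auto simp: \<C>_def)
  have mult: "a \<odot> b \<in> M" if "a \<in> M" "b \<in> M" for a b
    using Ms that unfolding subsemigroup_def by blast
  obtain a where a: "a \<in> M" using Ms unfolding subsemigroup_def by blast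
  have aB: "a \<in> betaS" using a Ms unfolding subsemigroup_def by blast
  have sub: "{b \<odot> a | b. b \<in> M} \<subseteq> M" using mult a by blast
  have "subsemigroup {b \<odot> a | b. b \<in> M}"
    unfolding subsemigroup_def
  proof (intro conjI ballI)
    show "{b \<odot> a | b. b \<in> M} \<noteq> {}" using a by blast
    show "{b \<odot> a | b. b \<in> M} \<subseteq> betaS" using sub Ms unfolding subsemigroup_def by blast
    show "p \<odot> q \<in> {b \<odot> a | b. b \<in> M}" if p: "p \<in> {b \<odot> a | b. b \<in> M}"
      and q: "q \<in> {b \<odot> a | b. b \<in> M}" for p q
    proof -
      obtain b where b: "b \<in> M" "q = b \<odot> a" using q by blast
      then have "p \<odot> q = (p \<odot> b) \<odot> a" by (simp add: beta_mult_assoc)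
      then show ?thesis using mult p sub b(1) by blast
    qed
  qed
  then have "{b \<odot> a | b. b \<in> M} = M"
    using min sub closedin_translate[OF Mc aB] ME by (simp add: \<C>_def)
  \<comment> \<open>Since the translate is all of \<open>M\<close>, it contains \<open>a\<close>
    itself; this makes the stabilizer nonempty.\<close>
  then obtain b where b: "b \<in> M" "b \<odot> a = a" using a by (smt (verit) mem_Collect_eq)
  \<comment> \<open>The stabilizer is closed as the preimage of the point \<open>a\<close>, closed
    by the Hausdorff property, under right multiplication by \<open>a\<close>.\<close>
  have "closedin beta_topology {b \<in> topspace beta_topology. b \<odot> a \<in> {a}}"
    using closedin_continuous_map_preimage[OF continuous_map_beta_mult_right[OF aB]]
      closedin_Hausdorff_singleton[OF Hausdorff_beta] aB unfolding topspace_beta by blast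
  then have "closedin beta_topology (M \<inter> {b \<in> topspace beta_topology. b \<odot> a \<in> {a}})"
    using Mc by blast
  moreover have "M \<inter> {b \<in> topspace beta_topology. b \<odot> a \<in> {a}} = {b \<in> M. b \<odot> a = a}"
    using Ms by (auto simp: subsemigroup_def)
  moreover have "subsemigroup {b \<in> M. b \<odot> a = a}"
    using b Ms by (auto simp: subsemigroup_def beta_mult_assoc)
  ultimately have "{b \<in> M. b \<odot> a = a} \<in> \<C>" using ME by (auto simp: \<C>_def)
  then have "{b \<in> M. b \<odot> a = a} = M" using min by blast
  then show ?thesis using that a ME by blast
qed

section \<open>The smallest ideal and its minimal left ideals\<close>

text \<open>Multiplying \<open>l\<close> on the left by an element \<open>p\<close> of an ideal
  \<open>I\<close> lands in both \<open>I\<close> and \<open>L\<close>. The left ideal generated by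
  \<open>p \<odot> l\<close> then stays in \<open>I\<close>, yet it is all of \<open>L\<close> by
  minimality.\<close>

lemma minimal_left_ideal_subset_smallest_ideal:
  assumes T: "subsemigroup T" and L: "minimal_left_ideal T L"
  shows "L \<subseteq> smallest_ideal T"
proof
  fix l assume l: "l \<in> L"
  have LT: "left_ideal T L" using L by (simp add: minimal_left_ideal_def)
  have "l \<in> I" if "two_sided_ideal T I" for I
  proof -
    have lI: "left_ideal T I" and rI: "right_ideal T I"
      using that by (auto simp: two_sided_ideal_def)
    obtain p where p: "p \<in> I" "p \<in> T" using lI unfolding left_ideal_def by blast
    have "l \<in> T" using LT l unfolding left_ideal_def by blast
    then have "p \<odot> l \<in> I" using rI p unfolding right_ideal_def by blast
    then have sub: "{t \<odot> (p \<odot> l) | t. t \<in> T} \<subseteq> I"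
      using lI unfolding left_ideal_def by blast
    have "p \<odot> l \<in> L" using LT p l unfolding left_ideal_def by blast
    then show ?thesis
      using sub translate_eq_minimal_left_ideal[OF T L] l by blast
  qed
  then show "l \<in> smallest_ideal T" by (simp add: smallest_ideal_def)
qed

lemma smallest_ideal_in_minimal_left_ideal:
  assumes T: "subsemigroup T" and closed: "closedin beta_topology T"
    and x: "x \<in> smallest_ideal T"
  obtains L where "minimal_left_ideal T L" "x \<in> L"
proof -
  obtain L where L: "minimal_left_ideal T L" using ex_minimal_left_ideal[OF T closed] .
  have LT: "left_ideal T L" using L by (simp add: minimal_left_ideal_def)
  \<comment> \<open>This is the product of \<open>L\<close> and \<open>T\<close>. It is a two-sided
    ideal, so it contains \<open>x\<close>, and it is a union of translates of \<open>L\<close>,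
    each a minimal left ideal.\<close>
  define I where "I = (\<Union>t\<in>T. {l \<odot> t | l. l \<in> L})"
  have tr: "left_ideal T {l \<odot> t | l. l \<in> L}" if "t \<in> T" for t
    using left_ideal_translate[OF T LT that] .
  have "I \<noteq> {}" using T LT by (auto simp: I_def subsemigroup_def left_ideal_def)
  moreover have "I \<subseteq> T" using tr unfolding I_def left_ideal_def by blast
  moreover have "s \<odot> r \<in> I" if s: "s \<in> T" and r: "r \<in> I" for s r
  proof -
    obtain t where t: "t \<in> T" "r \<in> {l \<odot> t | l. l \<in> L}" using r unfolding I_def by blast
    then have "s \<odot> r \<in> {l \<odot> t | l. l \<in> L}"
      using tr[OF t(1)] s by (simp only: left_ideal_def)
    then show ?thesis unfolding I_def by (rule UN_I[OF t(1)])
  qed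
  moreover have "r \<odot> s \<in> I" if s: "s \<in> T" and r: "r \<in> I" for s r
  proof -
    obtain l t where lt: "l \<in> L" "t \<in> T" "r = l \<odot> t" using r unfolding I_def by blast
    then have "t \<odot> s \<in> T" using T s unfolding subsemigroup_def by blast
    moreover have "r \<odot> s = l \<odot> (t \<odot> s)" using lt by (simp add: beta_mult_assoc)
    ultimately show ?thesis using lt(1) unfolding I_def by blast
  qed
  ultimately have "two_sided_ideal T I"
    by (simp add: two_sided_ideal_def left_ideal_def right_ideal_def)
  then have "x \<in> I" using x by (simp add: smallest_ideal_def)
  then obtain t where "t \<in> T" "x \<in> {l \<odot> t | l. l \<in> L}" unfolding I_def by blast
  then show ?thesis using that minimal_left_ideal_translate[OF T L] by blast
qed

text \<open>The algebraic half of the link through (r). Forwards, \<open>x\<close> and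
  \<open>p \<odot> x\<close> lie in one minimal left ideal, which \<open>p \<odot> x\<close>
  generates. Backwards, choosing \<open>p\<close> inside a given ideal makes
  \<open>x = q \<odot> (p \<odot> x)\<close> a member of that ideal.\<close>

lemma smallest_ideal_iff:
  assumes T: "subsemigroup T" and closed: "closedin beta_topology T" and x: "x \<in> T"
  shows "x \<in> smallest_ideal T \<longleftrightarrow> (\<forall>p\<in>T. x \<in> {q \<odot> (p \<odot> x) | q. q \<in> T})"
proof
  assume "x \<in> smallest_ideal T"
  then obtain L where L: "minimal_left_ideal T L" "x \<in> L"
    using smallest_ideal_in_minimal_left_ideal[OF T closed] by blast
  then have "p \<odot> x \<in> L" if "p \<in> T" for p
    using that unfolding minimal_left_ideal_def left_ideal_def by blast
  then show "\<forall>p\<in>T. x \<in> {q \<odot> (p \<odot> x) | q. q \<in> T}"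
    using translate_eq_minimal_left_ideal[OF T L(1)] L(2) by blast
next
  assume rec: "\<forall>p\<in>T. x \<in> {q \<odot> (p \<odot> x) | q. q \<in> T}"
  have "x \<in> I" if "two_sided_ideal T I" for I
  proof -
    have lI: "left_ideal T I" and rI: "right_ideal T I"
      using that by (auto simp: two_sided_ideal_def)
    obtain p where p: "p \<in> I" "p \<in> T" using lI unfolding left_ideal_def by blast
    then obtain q where "q \<in> T" "x = q \<odot> (p \<odot> x)" using rec by blast
    then show ?thesis using lI rI p x unfolding left_ideal_def right_ideal_def by metis
  qed
  then show "x \<in> smallest_ideal T" by (simp add: smallest_ideal_def)
qed

section \<open>Uniform recurrence in terms of products\<close>

lemma syndetic_mono:
  assumes "syndetic F A" "A \<subseteq> B"
  shows "syndetic F B"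
proof -
  have "set_quotient G A \<subseteq> set_quotient G B" for G
    using assms(2) by (auto simp: set_quotient_def left_quotient_def)
  then show ?thesis
    using assms(1) unfolding syndetic_def by (meson eventually_mono subsetD)
qed

lemma lambda_map_in_basic:
  assumes "x \<in> betaS"
  shows "lambda_map s x \<in> basic A \<longleftrightarrow> left_quotient s A \<in>\<^sub>F x"
  using beta_mult_in_betaS[OF principal_in_betaS assms, of s]
  by (simp only: basic_def mem_Collect_eq mem_lambda_map flip: lambda_map_def) simp

text \<open>Supersets of syndetic sets are syndetic, so it suffices to test basic neighbourhoods,
  whose sets of return times are described by left quotients.\<close>

lemma uniformly_recurrent_beta_iff:
  assumes x: "x \<in> betaS"
  shows "uniformly_recurrent F beta_topology lambda_map x \<longleftrightarrow>
    (\<forall>A. A \<in>\<^sub>F x \<longrightarrow> syndetic F {s. left_quotient s A \<in>\<^sub>F x})"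
proof
  assume rec: "uniformly_recurrent F beta_topology lambda_map x"
  show "\<forall>A. A \<in>\<^sub>F x \<longrightarrow> syndetic F {s. left_quotient s A \<in>\<^sub>F x}"
  proof (intro allI impI)
    fix A assume "A \<in>\<^sub>F x"
    then have "x \<in> basic A" using x by (simp add: basic_def)
    then have "syndetic F {s. lambda_map s x \<in> basic A}"
      using rec openin_basic basic_subset unfolding uniformly_recurrent_def topspace_beta by blast
    then show "syndetic F {s. left_quotient s A \<in>\<^sub>F x}"
      by (simp only: lambda_map_in_basic[OF x])
  qed
next
  assume syn: "\<forall>A. A \<in>\<^sub>F x \<longrightarrow> syndetic F {s. left_quotient s A \<in>\<^sub>F x}"
  have "syndetic F {s. lambda_map s x \<in> W}"
    if U: "openin beta_topology U" "x \<in> U" "U \<subseteq> W" for U W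
  proof -
    obtain A where A: "x \<in> basic A" "basic A \<subseteq> U"
      using basic_base[OF U(1,2)] by blast
    then have "A \<in>\<^sub>F x" by (simp add: basic_def)
    then have "syndetic F {s. lambda_map s x \<in> basic A}"
      using syn by (simp only: lambda_map_in_basic[OF x])
    then show ?thesis by (rule syndetic_mono) (use A U(3) in blast)
  qed
  then show "uniformly_recurrent F beta_topology lambda_map x"
    unfolding uniformly_recurrent_def topspace_beta using x by blast
qed

text \<open>Associativity in the semigroup moves \<open>x\<close> out of the set of return times and
  into a product with \<open>p\<close>. Both directions of the next equivalence use this
  translation.\<close>

lemma left_quotient_return_times:
  "left_quotient s {t. left_quotient t A \<in>\<^sub>F x} \<in>\<^sub>F p \<longleftrightarrow> left_quotient s A \<in>\<^sub>F p \<odot> x"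
  by (simp add: eventually_beta_mult left_quotient_def mult.assoc)

lemma uniformly_recurrent_closure_iff:
  assumes T: "subsemigroup (filter_closure F)"
    and closed: "closedin beta_topology (filter_closure F)"
    and x: "x \<in> filter_closure F"
  shows "uniformly_recurrent F beta_topology lambda_map x \<longleftrightarrow>
    (\<forall>p\<in>filter_closure F. x \<in> {q \<odot> (p \<odot> x) | q. q \<in> filter_closure F})"
    (is "_ \<longleftrightarrow> ?rec")
proof -
  let ?T = "filter_closure F"
  have T_beta: "p \<in> betaS" if "p \<in> ?T" for p
    using that by (simp add: filter_closure_def)
  have F_T: "A \<in>\<^sub>F p" if "A \<in>\<^sub>F F" "p \<in> ?T" for A p
    using that by (simp add: filter_closure_def)
  note xB = T_beta[OF x]
  show ?thesis
    unfolding uniformly_recurrent_beta_iff[OF xB]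
  proof
    assume syn: "\<forall>A. A \<in>\<^sub>F x \<longrightarrow> syndetic F {s. left_quotient s A \<in>\<^sub>F x}"
    show ?rec
    proof (intro ballI, rule ccontr)
      fix p assume p: "p \<in> ?T" and no: "x \<notin> {q \<odot> (p \<odot> x) | q. q \<in> ?T}"
      have pxB: "p \<odot> x \<in> betaS" using beta_mult_in_betaS T_beta[OF p] xB by blast
      then have "openin beta_topology (betaS - {q \<odot> (p \<odot> x) | q. q \<in> ?T})"
        using closedin_translate[OF closed] unfolding closedin_def topspace_beta by blast
      moreover have "x \<in> betaS - {q \<odot> (p \<odot> x) | q. q \<in> ?T}" using no xB by blast
      ultimately obtain A where A: "x \<in> basic A"
        "basic A \<subseteq> betaS - {q \<odot> (p \<odot> x) | q. q \<in> ?T}"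
        using basic_base by blast
      \<comment> \<open>No \<open>q\<close> in the closure has \<open>A\<close> in
        \<open>q \<odot> (p \<odot> x)\<close>, so this \<open>V\<close> belongs to every such
        \<open>q\<close> and hence to \<open>F\<close>. It is the set against which syndeticity is
        tested.\<close>
      define V where "V = - {s. left_quotient s A \<in>\<^sub>F p \<odot> x}"
      have "V \<in>\<^sub>F q" if q: "q \<in> ?T" for q
      proof -
        have "q \<odot> (p \<odot> x) \<notin> basic A" using A(2) q by blast
        then have "\<not> A \<in>\<^sub>F q \<odot> (p \<odot> x)"
          using beta_mult_in_betaS T_beta[OF q] pxB unfolding basic_def by blast
        then show ?thesis
          unfolding V_def ultra_not[OF T_beta[OF q]] mem_beta_mult[of A q] .
      qed
      then have "V \<in>\<^sub>F F" by (rule eventually_if_closure)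
      moreover have "A \<in>\<^sub>F x" using A(1) by (simp add: basic_def)
      ultimately obtain G where G: "finite G" "G \<subseteq> V"
        "set_quotient G {s. left_quotient s A \<in>\<^sub>F x} \<in>\<^sub>F F"
        using syn unfolding syndetic_def by blast
      \<comment> \<open>By the choice of \<open>V\<close>, no single quotient with \<open>s\<close>
        in \<open>G\<close> belongs to \<open>p\<close>. As \<open>G\<close> is finite, the
        complement of their union does, whereas the union belongs to \<open>F\<close> and thus to
        \<open>p\<close>.\<close>
      have "\<not> left_quotient s {t. left_quotient t A \<in>\<^sub>F x} \<in>\<^sub>F p" if "s \<in> G" for s
        using G(2) that unfolding left_quotient_return_times V_def by blast
      then have "\<forall>s\<in>G. (- left_quotient s {t. left_quotient t A \<in>\<^sub>F x}) \<in>\<^sub>F p"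
        unfolding ultra_not[OF T_beta[OF p]] by blast
      then have "eventually (\<lambda>y. \<forall>s\<in>G. y \<in> - left_quotient s {t. left_quotient t A \<in>\<^sub>F x}) p"
        by (rule eventually_ball_finite[OF G(1)])
      then have "(- set_quotient G {s. left_quotient s A \<in>\<^sub>F x}) \<in>\<^sub>F p"
        by (rule eventually_mono) (auto simp: set_quotient_def)
      then show False
        using F_T[OF G(3) p] unfolding ultra_not[OF T_beta[OF p]] by blast
    qed
  next
    assume rec: ?rec
    show "\<forall>A. A \<in>\<^sub>F x \<longrightarrow> syndetic F {s. left_quotient s A \<in>\<^sub>F x}"
      unfolding syndetic_def
    proof (intro allI impI)
      fix A V assume A: "A \<in>\<^sub>F x" and V: "V \<in>\<^sub>F F"
      define B where "B = {s. left_quotient s A \<in>\<^sub>F x}"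
      \<comment> \<open>For each \<open>p\<close>, condition (r) gives a \<open>q\<close> containing
        the set of \<open>s\<close> with \<open>left_quotient s A\<close> in
        \<open>p \<odot> x\<close>. Since \<open>q\<close> also contains \<open>V\<close>, the two
        sets meet, and a common element indexes a member of the cover containing
        \<open>p\<close>.\<close>
      have "?T \<subseteq> \<Union> ((\<lambda>s. basic (left_quotient s B)) ` V)"
      proof
        fix p assume p: "p \<in> ?T"
        then obtain q where q: "q \<in> ?T" "x = q \<odot> (p \<odot> x)" using rec by blast
        then have "{s. left_quotient s A \<in>\<^sub>F p \<odot> x} \<in>\<^sub>F q"
          using A mem_beta_mult by metis
        then have "eventually (\<lambda>s. left_quotient s A \<in>\<^sub>F p \<odot> x \<and> s \<in> V) q"
          using F_T[OF V q(1)] by (simp add: eventually_conj_iff)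
        moreover have "q \<noteq> bot" using T_beta[OF q(1)] by (simp add: betaS_def)
        ultimately obtain s where "left_quotient s A \<in>\<^sub>F p \<odot> x" "s \<in> V"
          using eventually_happens by blast
        then show "p \<in> \<Union> ((\<lambda>s. basic (left_quotient s B)) ` V)"
          using T_beta[OF p] left_quotient_return_times[of s A x p]
          unfolding basic_def B_def by blast
      qed
      moreover have "compactin beta_topology ?T"
        using closed closedin_compact_space compact_beta by blast
      moreover have "openin beta_topology U" if "U \<in> (\<lambda>s. basic (left_quotient s B)) ` V" for U
        using that openin_basic by blast
      ultimately obtain \<G> where \<G>: "finite \<G>" "\<G> \<subseteq> (\<lambda>s. basic (left_quotient s B)) ` V"
        "?T \<subseteq> \<Union>\<G>"
        using compactinD[of beta_topology ?T "(\<lambda>s. basic (left_quotient s B)) ` V"] by auto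
      then obtain G where G: "G \<subseteq> V" "finite G" "\<G> = (\<lambda>s. basic (left_quotient s B)) ` G"
        using finite_subset_image by meson
      have "set_quotient G B \<in>\<^sub>F F"
      proof (rule eventually_if_closure)
        fix p assume "p \<in> ?T"
        then obtain s where "s \<in> G" "left_quotient s B \<in>\<^sub>F p"
          using \<G>(3) G(3) unfolding basic_def by blast
        then show "set_quotient G B \<in>\<^sub>F p"
          by (auto simp: set_quotient_def elim: eventually_mono)
      qed
      then show "\<exists>G. finite G \<and> G \<subseteq> V \<and>
          set_quotient G {s. left_quotient s A \<in>\<^sub>F x} \<in>\<^sub>F F"
        using G unfolding B_def by blast
    qed
  qed
qed

section \<open>The converse under left cancelability\<close>

text \<open>Minimality puts the translate of \<open>T\<close> by \<open>x\<close> into the smallest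
  ideal, but \<open>x\<close> itself is not known to lie in that translate. Cancelability serves to
  place it there.\<close>

lemma smallest_ideal_if_left_cancelable:
  assumes T: "subsemigroup T" and closed: "closedin beta_topology T" and x: "x \<in> T"
    and min: "minimal_left_ideal T {p \<odot> x | p. p \<in> T}"
    and z: "left_cancelable T z"
  shows "x \<in> smallest_ideal T"
proof -
  define L where "L = {p \<odot> x | p. p \<in> T}"
  have L: "minimal_left_ideal T L" and LT: "left_ideal T L"
    using min by (auto simp: L_def minimal_left_ideal_def)
  have xB: "x \<in> betaS" using T x unfolding subsemigroup_def by blast
  have "subsemigroup L" using T LT unfolding subsemigroup_def left_ideal_def by blast
  then obtain e where e: "e \<in> L" "e \<odot> e = e"
    using ex_idempotent closedin_translate[OF closed xB] unfolding L_def by blast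
  have zT: "z \<in> T" using z by (simp add: left_cancelable_def)
  then have "z \<odot> x \<in> L" using x by (auto simp: L_def)
  then obtain p where "p \<in> T" "z \<odot> x = p \<odot> e"
    using translate_eq_minimal_left_ideal[OF T L e(1)] by blast
  \<comment> \<open>Since \<open>z \<odot> x\<close> has the form \<open>p \<odot> e\<close> with
    \<open>e\<close> idempotent, multiplying it by \<open>e\<close> on the right changes nothing.
    Cancelling \<open>z\<close> below then gives \<open>x \<odot> e = x\<close>.\<close>
  then have "z \<odot> (x \<odot> e) = z \<odot> x"
    using e(2) by (metis beta_mult_assoc)
  moreover have xe: "x \<odot> e \<in> L" using LT x e(1) unfolding left_ideal_def by blast
  moreover have "x \<odot> e \<in> T" using xe LT unfolding left_ideal_def by blast
  ultimately have "x \<in> L" using z x unfolding left_cancelable_def by metis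
  then show ?thesis using minimal_left_ideal_subset_smallest_ideal[OF T L] by blast
qed

theorem theorem6p5:
  fixes F :: "'a::semigroup_mult filter" and x :: "'a filter"
  assumes "F \<noteq> bot"
    and "closedin beta_topology (filter_closure F)"
    and "subsemigroup (filter_closure F)"
    and "x \<in> filter_closure F"
  shows "(x \<in> smallest_ideal (filter_closure F) \<longleftrightarrow>
            uniformly_recurrent F beta_topology lambda_map x) \<and>
         (x \<in> smallest_ideal (filter_closure F) \<longrightarrow>
            minimal_left_ideal (filter_closure F) {p \<odot> x | p. p \<in> filter_closure F}) \<and>
         ((\<exists>z. left_cancelable (filter_closure F) z) \<longrightarrow>
            (uniformly_recurrent F beta_topology lambda_map x \<longleftrightarrow>
             minimal_left_ideal (filter_closure F) {p \<odot> x | p. p \<in> filter_closure F}))"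
proof -
  let ?T = "filter_closure F"
  \<comment> \<open>Both sides unfold to the same condition (r).\<close>
  have ab: "x \<in> smallest_ideal ?T \<longleftrightarrow> uniformly_recurrent F beta_topology lambda_map x"
    unfolding smallest_ideal_iff[OF assms(3,2,4)] uniformly_recurrent_closure_iff[OF assms(3,2,4)] ..
  have ac: "minimal_left_ideal ?T {p \<odot> x | p. p \<in> ?T}" if x: "x \<in> smallest_ideal ?T"
  proof -
    obtain L where L: "minimal_left_ideal ?T L" "x \<in> L"
      using smallest_ideal_in_minimal_left_ideal[OF assms(3,2) x] .
    then show ?thesis using translate_eq_minimal_left_ideal[OF assms(3)] by simp
  qed
  have "x \<in> smallest_ideal ?T"
    if "left_cancelable ?T z" "minimal_left_ideal ?T {p \<odot> x | p. p \<in> ?T}" for z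
    using smallest_ideal_if_left_cancelable[OF assms(3,2,4) that(2,1)] .
  with ab ac show ?thesis by blast
qed

end
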